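(* Let $0\le k\le d$ be integers. Suppose we are given $d-k+1$ pairs $\{H_i^0,H_i^1\}$, $i=1,\dots,d-k+1$, of $k$-flats in $\mathbb{R}^d$. Then there exists a partition of these $2(d-k+1)$ flats into two collections $A,B$ such that each of $A$ and $B$ contains exactly one $k$-flat from each pair (that is, for some $\varepsilon_1,\dots,\varepsilon_{d-k+1}\in\{0,1\}$, $A$ consists of the flats $H_i^{\varepsilon_i}$ and $B$ consists of the flats $H_i^{1-\varepsilon_i}$), and such that $\operatorname{conv}\left(\bigcup A\right)\cap\operatorname{conv}\left(\bigcup B\right)$ contains a $k$-flat.
   Context: A $k$-flat in $\mathbb{R}^d$ is a $k$-dimensional affine subspace (a $0$-flat is a point). $\bigcup A$ denotes the union, as a subset of $\mathbb{R}^d$, of all the flats in $A$, and $\operatorname{conv}$ denotes the convex hull (no closure is taken). *)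

theory Defs
  imports "HOL-Analysis.Analysis"
begin

text \<open>
  The ambient space \<open>\<real>\<^sup>d\<close> is represented by a \<open>d\<close>-dimensional linear subspace \<open>V\<close> of an arbitrary
  Euclidean space: types of class \<^class>\<open>euclidean_space\<close> have dimension at least 1, so the case
  \<open>d = 0\<close> would be lost with \<open>\<real>\<^sup>d\<close> as a type. Taking \<open>V = UNIV\<close> gives every \<open>d \<ge> 1\<close>, and
  \<open>V = {0}\<close> gives \<open>d = 0\<close>.
\<close>

definition flat_in :: "'a::euclidean_space set \<Rightarrow> nat \<Rightarrow> 'a set \<Rightarrow> bool" where
  "flat_in V k F \<longleftrightarrow> affine F \<and> aff_dim F = int k \<and> F \<subseteq> V"

end

theory Submission
  imports Defs
begin

text \<open>
  Pick points \<open>h i e\<close> of the flats, let \<open>L i e\<close> be their directions and put \<open>w i = h i 0 - h i 1\<close>. For a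
  set \<open>I\<close> of pairs let \<open>M\<close> be the span of all their directions; whatever the partition, the two
  direction spans \<open>P\<close> and \<open>Q\<close> of the classes satisfy \<open>P + Q = M\<close>. If \<open>\<Sum>i\<in>I. l i * w i\<close> lies in \<open>M\<close>
  with all \<open>l i \<noteq> 0\<close>, then partitioning by the signs of \<open>l\<close> and using the weights \<open>\<bar>l i\<bar>\<close> yields points
  \<open>a\<close> and \<open>b\<close> with \<open>a + P\<close> and \<open>b + Q\<close> inside the two convex hulls and \<open>a - b \<in> P + Q\<close>. So the hulls
  share a translate of \<open>P \<inter> Q\<close>, and it remains to achieve \<open>dim (P \<inter> Q) \<ge> k\<close>. For \<open>I\<close> minimal with
  \<open>|I| + k > dim (M + span w)\<close>, every index occurs in some dependency modulo \<open>M\<close>, and the signs of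
  at least \<open>dim M - k + 1\<close> of the coefficients can be prescribed. They are chosen greedily: as long
  as \<open>dim (P \<inter> Q) < k\<close>, each new pair can be placed so that \<open>dim P + dim Q\<close> grows.
\<close>

section \<open>Linear dependencies modulo a subspace and the choice of their signs\<close>

lemma span_image_coefficients:
  fixes w :: "'i \<Rightarrow> 'a::real_vector"
  assumes "finite J" "subspace M" "x \<in> span (M \<union> w ` J)"
  shows "\<exists>c. x - (\<Sum>j\<in>J. c j *\<^sub>R w j) \<in> M"
  using assms(1,3)
proof (induction J arbitrary: x)
  case empty
  then show ?case using assms(2) by (auto simp: span_eq_iff[THEN iffD2])
next
  case (insert j J)
  then have "x \<in> span (insert (w j) (M \<union> w ` J))" by simp
  then obtain a where "x - a *\<^sub>R w j \<in> span (M \<union> w ` J)"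
    unfolding span_breakdown_eq by blast
  from insert.IH[OF this] obtain c
    where c: "x - a *\<^sub>R w j - (\<Sum>j\<in>J. c j *\<^sub>R w j) \<in> M" by blast
  have "(\<Sum>i\<in>J. (c(j := a)) i *\<^sub>R w i) = (\<Sum>i\<in>J. c i *\<^sub>R w i)"
    by (rule sum.cong) (use insert.hyps in auto)
  then have "x - (\<Sum>i\<in>insert j J. (c(j := a)) i *\<^sub>R w i) \<in> M"
    using c insert.hyps by (simp add: algebra_simps)
  then show ?case by blast
qed

text \<open>Greedy choice: \<open>w i\<close> is kept exactly when it lies outside the span built so
  far, so each kept vector costs one dimension. Coefficients at indices outside \<open>J\<close> can
  later be prescribed, those in \<open>J\<close> solving for the rest.\<close>

lemma spanning_subfamily_mod:
  fixes w :: "'i \<Rightarrow> 'a::euclidean_space"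
  assumes "finite I"
  shows "\<exists>J\<subseteq>I. span (M \<union> w ` J) = span (M \<union> w ` I) \<and> dim M + card J \<le> dim (M \<union> w ` I)"
  using assms
proof induction
  case empty
  then show ?case by auto
next
  case (insert i I)
  then obtain J where J: "J \<subseteq> I" "span (M \<union> w ` J) = span (M \<union> w ` I)"
    "dim M + card J \<le> dim (M \<union> w ` I)" by blast
  have ins: "M \<union> w ` insert i I = insert (w i) (M \<union> w ` I)" by auto
  show ?case
  proof (cases "w i \<in> span (M \<union> w ` I)")
    case True
    then show ?thesis
      using J by (intro exI[of _ J]) (auto simp: ins dim_insert span_redundant)
  next
    case False
    have "span (M \<union> w ` insert i J) = span (M \<union> w ` insert i I)"
      using J(2) by (simp add: span_insert)
    moreover have "card (insert i J) \<le> Suc (card J)"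
      by (rule card_insert_le_m1) auto
    ultimately show ?thesis
      using J False by (intro exI[of _ "insert i J"]) (auto simp: dim_insert)
  qed
qed

text \<open>While the two spans meet in dimension below \<open>k\<close>, they cannot both contain
  \<open>L i True\<close>; placing it in a class whose span misses it raises the sum of the
  dimensions. Once the intersection has dimension at least \<open>k\<close>, further pairs only
  enlarge it. The final \<open>+ 1\<close> reflects the first pair, which contributes just
  \<open>2 * k\<close>.\<close>

lemma orientation_dim_sum:
  fixes L :: "'i \<Rightarrow> bool \<Rightarrow> 'a::euclidean_space set"
  assumes "finite T" "T \<noteq> {}" "\<And>i e. i \<in> T \<Longrightarrow> k \<le> dim (L i e)"
  shows "\<exists>s. k \<le> dim (span (\<Union>i\<in>T. L i (s i)) \<inter> span (\<Union>i\<in>T. L i (\<not> s i))) \<or>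
    2 * k + card T \<le> dim (\<Union>i\<in>T. L i (s i)) + dim (\<Union>i\<in>T. L i (\<not> s i)) + 1"
  using assms
proof (induction rule: finite_ne_induct)
  case (singleton i)
  have "k \<le> dim (L i True)" "k \<le> dim (L i False)" using singleton by auto
  then show ?case by (intro exI[of _ "\<lambda>_. True"]) auto
next
  case (insert i T)
  then obtain s where s:
    "k \<le> dim (span (\<Union>i\<in>T. L i (s i)) \<inter> span (\<Union>i\<in>T. L i (\<not> s i))) \<or>
     2 * k + card T \<le> dim (\<Union>i\<in>T. L i (s i)) + dim (\<Union>i\<in>T. L i (\<not> s i)) + 1"
    by auto
  define P where "P = (\<Union>i\<in>T. L i (s i))"
  define Q where "Q = (\<Union>i\<in>T. L i (\<not> s i))"
  have P': "(\<Union>j\<in>insert i T. L j ((s(i := b)) j)) = L i b \<union> P"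
    and Q': "(\<Union>j\<in>insert i T. L j (\<not> (s(i := b)) j)) = L i (\<not> b) \<union> Q" for b
    using insert.hyps unfolding P_def Q_def by (auto split: if_splits)
  have *: ?case if "k \<le> dim (span (L i b \<union> P) \<inter> span (L i (\<not> b) \<union> Q)) \<or>
      2 * k + card (insert i T) \<le> dim (L i b \<union> P) + dim (L i (\<not> b) \<union> Q) + 1" for b
    using that by (intro exI[of _ "s(i := b)"]) (simp only: P' Q')
  have mono: "dim P \<le> dim (L i b \<union> P)" "dim Q \<le> dim (L i b \<union> Q)" for b
    by (auto intro: dim_subset)
  have strict: "dim R < dim (X \<union> R)" if "\<not> X \<subseteq> span R" for R X :: "'a set"
  proof (rule dim_psubset)
    have "span R \<subseteq> span (X \<union> R)" "X \<subseteq> span (X \<union> R)"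
      by (auto intro: span_base span_mono[THEN subsetD])
    then show "span R \<subset> span (X \<union> R)" using that by blast
  qed
  show ?case
  proof (cases "k \<le> dim (span P \<inter> span Q)")
    case True
    also have "dim (span P \<inter> span Q) \<le> dim (span (L i True \<union> P) \<inter> span (L i False \<union> Q))"
      by (intro dim_subset Int_mono span_mono) auto
    finally show ?thesis using *[of True] by simp
  next
    case False
    then have s': "2 * k + card T \<le> dim P + dim Q + 1" using s P_def Q_def by auto
    have "\<not> L i True \<subseteq> span P \<inter> span Q"
      using False insert.prems[of i True] dim_subset[of "L i True" "span P \<inter> span Q"] by auto
    then consider "\<not> L i True \<subseteq> span P" | "\<not> L i True \<subseteq> span Q" by blast
    then show ?thesis
    proof cases
      case 1
      then show ?thesis
        using *[of True] strict[OF 1] s' insert.hyps mono(2)[of False] by simp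
    next
      case 2
      then show ?thesis
        using *[of False] strict[OF 2] s' insert.hyps mono(1)[of False] by simp
    qed
  qed
qed

text \<open>Zeros in \<open>J\<close> are removed one at a time by adding \<open>t * m\<close> with
  \<open>m j \<noteq> 0\<close> and small \<open>t > 0\<close>: coordinate \<open>j\<close> becomes
  nonzero, and every nonzero coordinate in \<open>I\<close> keeps its sign.\<close>

lemma perturb_to_full_support:
  fixes R :: "('i \<Rightarrow> real) set" and l :: "'i \<Rightarrow> real"
  assumes "finite I" "finite J"
    and R: "\<And>l m t. l \<in> R \<Longrightarrow> m \<in> R \<Longrightarrow> (\<lambda>i. l i + t * m i) \<in> R"
    and "l \<in> R" and "\<And>j. j \<in> J \<Longrightarrow> \<exists>m\<in>R. m j \<noteq> 0" and "J \<subseteq> I"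
  shows "\<exists>l'\<in>R. (\<forall>i\<in>I. l i \<noteq> 0 \<longrightarrow> sgn (l' i) = sgn (l i)) \<and> (\<forall>j\<in>J. l' j \<noteq> 0)"
  using assms(2,5,6)
proof induction
  case empty
  then show ?case using assms(4) by auto
next
  case (insert j J)
  then obtain l' where l': "l' \<in> R" "\<forall>i\<in>I. l i \<noteq> 0 \<longrightarrow> sgn (l' i) = sgn (l i)"
    "\<forall>j\<in>J. l' j \<noteq> 0" by auto
  obtain m where m: "m \<in> R" "m j \<noteq> 0" using insert.prems by auto
  show ?case
  proof (cases "l' j = 0")
    case False
    then show ?thesis using l' by auto
  next
    case True
    have "\<forall>\<^sub>F t in at_right 0. l' i \<noteq> 0 \<longrightarrow> sgn (l' i + t * m i) = sgn (l' i)" for i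
    proof (cases "l' i" "0 :: real" rule: linorder_cases)
      case less
      have "((\<lambda>t. l' i + t * m i) \<longlongrightarrow> l' i + 0 * m i) (at_right 0)"
        by (intro tendsto_intros)
      then have "\<forall>\<^sub>F t in at_right 0. l' i + t * m i < 0"
        using less by (intro order_tendstoD) auto
      then show ?thesis by (rule eventually_mono) (use less in auto)
    next
      case greater
      have "((\<lambda>t. l' i + t * m i) \<longlongrightarrow> l' i + 0 * m i) (at_right 0)"
        by (intro tendsto_intros)
      then have "\<forall>\<^sub>F t in at_right 0. l' i + t * m i > 0"
        using greater by (intro order_tendstoD) auto
      then show ?thesis by (rule eventually_mono) (use greater in auto)
    qed auto
    then have "\<forall>\<^sub>F t in at_right 0. \<forall>i\<in>I. l' i \<noteq> 0 \<longrightarrow> sgn (l' i + t * m i) = sgn (l' i)"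
      using assms(1) by (simp add: eventually_ball_finite)
    moreover have "\<forall>\<^sub>F t in at_right (0::real). t > 0" by (rule eventually_at_right_less)
    ultimately have "\<forall>\<^sub>F t in at_right 0. t > 0 \<and>
        (\<forall>i\<in>I. l' i \<noteq> 0 \<longrightarrow> sgn (l' i + t * m i) = sgn (l' i))"
      by eventually_elim auto
    then obtain t where t: "t > 0" "\<forall>i\<in>I. l' i \<noteq> 0 \<longrightarrow> sgn (l' i + t * m i) = sgn (l' i)"
      using eventually_happens'[OF trivial_limit_at_right_real] by blast
    show ?thesis
    proof (intro bexI[of _ "\<lambda>i. l' i + t * m i"] conjI ballI impI)
      fix i assume "i \<in> I" "l i \<noteq> 0"
      then show "sgn (l' i + t * m i) = sgn (l i)" using l'(2) t(2) by (metis sgn_eq_0_iff)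
    next
      fix i assume "i \<in> insert j J"
      then show "l' i + t * m i \<noteq> 0"
        using True m t l'(3) insert.prems by (metis add_0 insertE insert_subset mult_eq_0_iff order_less_irrefl sgn_eq_0_iff subset_iff)
    qed (use R l' m in auto)
  qed
qed

text \<open>The sign of \<open>l i\<close> encodes the partition: a negative coefficient puts
  \<open>L i True\<close> into the first span and \<open>L i False\<close> into the second.\<close>

lemma oriented_dependency:
  fixes L :: "'i \<Rightarrow> bool \<Rightarrow> 'a::euclidean_space set" and w :: "'i \<Rightarrow> 'a"
  assumes "finite I0" "I0 \<noteq> {}"
    and "\<And>i e. i \<in> I0 \<Longrightarrow> k \<le> dim (L i e)"
    and "\<And>i e. i \<in> I0 \<Longrightarrow> L i e \<subseteq> V" and "\<And>i. i \<in> I0 \<Longrightarrow> w i \<in> V"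
    and "dim V + 1 \<le> card I0 + k"
  obtains I l where "I \<subseteq> I0" "I \<noteq> {}" "\<And>i. i \<in> I \<Longrightarrow> l i \<noteq> (0::real)"
    "(\<Sum>i\<in>I. l i *\<^sub>R w i) \<in> span (\<Union>i\<in>I. L i True \<union> L i False)"
    "k \<le> dim (span (\<Union>i\<in>I. L i (l i < 0)) \<inter> span (\<Union>i\<in>I. L i (\<not> l i < 0)))"
proof -
  define D where "D I = (\<Union>i\<in>I. L i True \<union> L i False)" for I
  define M where "M I = span (D I)" for I
  define N where "N I = M I \<union> w ` I" for I
  \<comment> \<open>Since \<open>N I0\<close> has dimension at most \<open>dim V\<close>, the full
    set \<open>I0\<close> is good. Passing to a good set of least cardinality makes every
    \<open>w i\<close> redundant.\<close>
  define good where "good I \<longleftrightarrow> I \<subseteq> I0 \<and> I \<noteq> {} \<and> dim (N I) + 1 \<le> card I + k" for I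
  have dimN: "dim (N I) = dim (D I \<union> w ` I)" for I
  proof -
    have "span (N I) = span (D I \<union> w ` I)"
      unfolding N_def M_def by (simp only: span_Un span_span)
    then show ?thesis by (metis dim_span)
  qed
  have "dim (N I0) \<le> dim V"
    unfolding dimN using assms(4,5) by (intro dim_subset) (auto simp: D_def)
  then have "good I0" using assms unfolding good_def by auto
  then obtain I where I: "good I" and min: "\<And>I'. good I' \<Longrightarrow> card I \<le> card I'"
    using ex_has_least_nat[of good I0 card] by blast
  have I': "I \<subseteq> I0" "I \<noteq> {}" "dim (N I) + 1 \<le> card I + k" "finite I"
    using I assms(1) unfolding good_def by (auto intro: finite_subset)
  have kM: "k \<le> dim (M I)"
  proof -
    obtain i where "i \<in> I" using I' by blast
    then have "L i True \<subseteq> D I" unfolding D_def by auto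
    then show ?thesis
      using assms(3)[of i True] I' \<open>i \<in> I\<close> dim_subset[of "L i True" "D I"] by (auto simp: M_def)
  qed
  \<comment> \<open>If \<open>I = {i}\<close>, goodness gives
    \<open>dim (N I) \<le> k \<le> dim (M I)\<close>, so \<open>M I\<close> already spans
    \<open>N I\<close>. Otherwise \<open>I - {i}\<close> is nonempty but not good, although its
    cardinality drops by only one, so its \<open>N\<close> has the same span as
    \<open>N I\<close>.\<close>
  have redundant: "w i \<in> span (M I \<union> w ` (I - {i}))" if i: "i \<in> I" for i
  proof (cases "I = {i}")
    case True
    then have "dim (N I) \<le> k" using I' by auto
    then have "span (M I) = span (N I)"
      using kM by (intro dim_eq_span) (auto simp: N_def)
    then have "w i \<in> span (M I)" using i by (auto simp: N_def intro: span_base)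
    then show ?thesis using span_mono[of "M I" "M I \<union> w ` (I - {i})"] by auto
  next
    case False
    have card: "card (I - {i}) + 1 = card I" using i I' by (metis Suc_eq_plus1 card.remove)
    then have "\<not> good (I - {i})" using min[of "I - {i}"] by auto
    moreover have "I - {i} \<subseteq> I0" "I - {i} \<noteq> {}" using I' False i by auto
    ultimately have le: "dim (N I) \<le> dim (N (I - {i}))"
      using I'(3) card unfolding good_def by linarith
    have "M (I - {i}) \<subseteq> M I" unfolding M_def by (intro span_mono) (auto simp: D_def)
    then have sub: "N (I - {i}) \<subseteq> N I" "N (I - {i}) \<subseteq> M I \<union> w ` (I - {i})"
      by (auto simp: N_def)
    have "w i \<in> span (N I)" using i by (auto simp: N_def intro: span_base)
    also have "\<dots> = span (N (I - {i}))" using dim_eq_span[OF sub(1) le] by simp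
    also have "\<dots> \<subseteq> span (M I \<union> w ` (I - {i}))" using sub(2) by (rule span_mono)
    finally show ?thesis .
  qed
  have subM: "subspace (M I)" unfolding M_def by simp
  \<comment> \<open>The coefficient families of dependencies modulo \<open>M I\<close>; redundancy
    of \<open>w i\<close> gives a member with coefficient 1 at \<open>i\<close>.\<close>
  define R where "R = {l. (\<Sum>i\<in>I. l i *\<^sub>R w i) \<in> M I}"
  have R_lin: "(\<lambda>i. l i + t * m i) \<in> R" if "l \<in> R" "m \<in> R" for l m t
  proof -
    have "(\<Sum>i\<in>I. (l i + t * m i) *\<^sub>R w i) = (\<Sum>i\<in>I. l i *\<^sub>R w i) + t *\<^sub>R (\<Sum>i\<in>I. m i *\<^sub>R w i)"
      by (simp add: algebra_simps sum.distrib scaleR_sum_right)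
    then show ?thesis using that subM unfolding R_def
      by (simp add: subspace_add subspace_scale)
  qed
  have R_nonzero: "\<exists>m\<in>R. m i \<noteq> 0" if i: "i \<in> I" for i
  proof -
    obtain c where c: "w i - (\<Sum>j\<in>I - {i}. c j *\<^sub>R w j) \<in> M I"
      using span_image_coefficients[OF _ subM redundant[OF i]] I' by auto
    let ?m = "\<lambda>j. if j = i then 1 else - c j"
    have "(\<Sum>j\<in>I. ?m j *\<^sub>R w j) = w i + (\<Sum>j\<in>I - {i}. ?m j *\<^sub>R w j)"
      using i I' by (simp add: sum.remove)
    also have "(\<Sum>j\<in>I - {i}. ?m j *\<^sub>R w j) = - (\<Sum>j\<in>I - {i}. c j *\<^sub>R w j)"
      unfolding sum_negf[symmetric] by (rule sum.cong) auto
    finally show ?thesis using c by (intro bexI[of _ ?m]) (auto simp: R_def)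
  qed
  obtain J where J: "J \<subseteq> I" "span (M I \<union> w ` J) = span (N I)" "dim (M I) + card J \<le> dim (N I)"
    using spanning_subfamily_mod[OF I'(4), of "M I" w] unfolding N_def by blast
  have finJ: "finite J" using J I' finite_subset by blast
  \<comment> \<open>The indices with free coefficients. From
    \<open>card J \<le> dim (N I) - dim (M I)\<close> and goodness there are at least
    \<open>dim (M I) - k + 1\<close> of them.\<close>
  define T where "T = I - J"
  have "card T + card J = card I" unfolding T_def using J I' finJ
    by (simp add: card_Diff_subset card_mono)
  then have cardT: "dim (M I) + 1 \<le> card T + k" using J I' by linarith
  have T: "finite T" "T \<subseteq> I" using I' by (auto simp: T_def)
  have "card T \<noteq> 0" using cardT kM by linarith
  then have "T \<noteq> {}" by auto
  obtain s where s:
    "k \<le> dim (span (\<Union>i\<in>T. L i (s i)) \<inter> span (\<Union>i\<in>T. L i (\<not> s i))) \<or>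
     2 * k + card T \<le> dim (\<Union>i\<in>T. L i (s i)) + dim (\<Union>i\<in>T. L i (\<not> s i)) + 1"
    using orientation_dim_sum[OF T(1) \<open>T \<noteq> {}\<close>, of k L] assms(3) T(2) I'(1) by blast
  \<comment> \<open>Coefficients on \<open>T\<close> have the signs demanded by \<open>s\<close>;
    those on \<open>J\<close> are solved for and may vanish, which the later perturbation repairs
    without changing the signs on \<open>T\<close>.\<close>
  define g where "g i = (if s i then - 1 else 1 :: real)" for i
  have "(\<Sum>i\<in>T. g i *\<^sub>R w i) \<in> span (M I \<union> w ` J)"
    unfolding J(2) using T(2) by (intro span_sum span_scale span_base) (auto simp: N_def)
  from span_image_coefficients[OF finJ subM this] obtain c
    where c: "(\<Sum>i\<in>T. g i *\<^sub>R w i) - (\<Sum>j\<in>J. c j *\<^sub>R w j) \<in> M I" by blast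
  define l0 where "l0 i = (if i \<in> T then g i else - c i)" for i
  have "(\<Sum>i\<in>I. l0 i *\<^sub>R w i) = (\<Sum>i\<in>T. l0 i *\<^sub>R w i) + (\<Sum>i\<in>J. l0 i *\<^sub>R w i)"
    unfolding T_def using sum.subset_diff[OF J(1) I'(4)] by blast
  also have "(\<Sum>i\<in>T. l0 i *\<^sub>R w i) = (\<Sum>i\<in>T. g i *\<^sub>R w i)"
    by (rule sum.cong) (auto simp: l0_def)
  also have "(\<Sum>i\<in>J. l0 i *\<^sub>R w i) = - (\<Sum>i\<in>J. c i *\<^sub>R w i)"
    unfolding sum_negf[symmetric] by (rule sum.cong) (auto simp: l0_def T_def)
  finally have "l0 \<in> R" using c by (simp add: R_def)
  then obtain l where l: "l \<in> R" "\<forall>i\<in>I. l0 i \<noteq> 0 \<longrightarrow> sgn (l i) = sgn (l0 i)" "\<forall>i\<in>I. l i \<noteq> 0"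
    using perturb_to_full_support[OF I'(4) I'(4) R_lin _ R_nonzero, of l0] by blast
  have sl: "s i \<longleftrightarrow> l i < 0" if "i \<in> T" for i
  proof -
    have "l0 i = (if s i then - 1 else 1)" using that by (simp add: l0_def g_def)
    then have "sgn (l i) = (if s i then - 1 else 1)"
      using l(2) that T(2) by auto
    then show ?thesis by (auto simp: sgn_if split: if_splits)
  qed
  define P where "P = (\<Union>i\<in>I. L i (l i < 0))"
  define Q where "Q = (\<Union>i\<in>I. L i (\<not> l i < 0))"
  have PT: "(\<Union>i\<in>T. L i (s i)) \<subseteq> P" and QT: "(\<Union>i\<in>T. L i (\<not> s i)) \<subseteq> Q"
    using sl T(2) unfolding P_def Q_def by fastforce+
  have PQ: "P \<union> Q = D I" unfolding P_def Q_def D_def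
    by (auto; metis (full_types))
  have "k \<le> dim (span P \<inter> span Q)"
    using s
  proof
    assume "k \<le> dim (span (\<Union>i\<in>T. L i (s i)) \<inter> span (\<Union>i\<in>T. L i (\<not> s i)))"
    also have "\<dots> \<le> dim (span P \<inter> span Q)"
      by (intro dim_subset Int_mono span_mono PT QT)
    finally show ?thesis .
  next
    assume a: "2 * k + card T \<le> dim (\<Union>i\<in>T. L i (s i)) + dim (\<Union>i\<in>T. L i (\<not> s i)) + 1"
    \<comment> \<open>The sum of the two spans is \<open>M I\<close> for any orientation, so the
      dimension formula gives \<open>dim (span P \<inter> span Q) \<ge> 2 * k + card T - 1 - dim (M
      I) \<ge> k\<close>.\<close>
    have "{x + y |x y. x \<in> span P \<and> y \<in> span Q} = M I"
      unfolding M_def PQ[symmetric] span_Un by auto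
    then have "dim (M I) + dim (span P \<inter> span Q) = dim P + dim Q"
      using dim_sums_Int[of "span P" "span Q"] by simp
    then show ?thesis
      using a cardT dim_subset[OF PT] dim_subset[OF QT] by linarith
  qed
  then show thesis
    using l I' by (intro that[of I l]) (auto simp: P_def Q_def R_def M_def D_def)
qed

section \<open>From direction spans to flats inside the convex hulls\<close>

lemma span_UN_decompose:
  fixes L :: "'i \<Rightarrow> 'a::real_vector set"
  assumes "finite I" "\<And>i. i \<in> I \<Longrightarrow> subspace (L i)" "u \<in> span (\<Union>i\<in>I. L i)"
  shows "\<exists>f. (\<forall>i\<in>I. f i \<in> L i) \<and> u = sum f I"
  using assms
proof (induction I arbitrary: u)
  case empty
  then show ?case by auto
next
  case (insert i I)
  then obtain x y where xy: "u = x + y" "x \<in> L i" "y \<in> span (\<Union>i\<in>I. L i)"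
    by (auto simp: span_Un span_eq_iff[THEN iffD2])
  obtain f where f: "\<forall>i\<in>I. f i \<in> L i" "y = sum f I"
    using insert.IH[OF _ xy(3)] insert.prems by auto
  have "sum (f(i := x)) I = sum f I" by (rule sum.cong) (use insert.hyps in auto)
  then show ?case using f xy insert.hyps by (intro exI[of _ "f(i := x)"]) auto
qed

text \<open>Write \<open>u\<close> as a sum of \<open>f i \<in> L i\<close>. As
  \<open>c i > 0\<close>, shifting \<open>h i\<close> by \<open>(1 / c i) *\<^sub>R f i\<close>
  stays in \<open>X\<close> and changes the weighted sum by exactly \<open>f i\<close>.\<close>

lemma translated_span_in_convex_hull:
  fixes L :: "'i \<Rightarrow> 'a::real_vector set"
  assumes "finite I" "\<And>i. i \<in> I \<Longrightarrow> subspace (L i)" "\<And>i. i \<in> I \<Longrightarrow> 0 < c i" "sum c I = 1"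
    and "\<And>i v. i \<in> I \<Longrightarrow> v \<in> L i \<Longrightarrow> h i + v \<in> X" and "u \<in> span (\<Union>i\<in>I. L i)"
  shows "(\<Sum>i\<in>I. c i *\<^sub>R h i) + u \<in> convex hull X"
proof -
  obtain f where f: "\<forall>i\<in>I. f i \<in> L i" "u = sum f I"
    using span_UN_decompose[OF assms(1,2,6)] by blast
  have "(\<Sum>i\<in>I. c i *\<^sub>R (h i + (1 / c i) *\<^sub>R f i)) \<in> convex hull X"
  proof (rule convex_sum)
    fix i assume i: "i \<in> I"
    then have "(1 / c i) *\<^sub>R f i \<in> L i" using f assms(2) by (blast intro: subspace_scale)
    then show "h i + (1 / c i) *\<^sub>R f i \<in> convex hull X"
      using assms(5) i by (blast intro: hull_inc)
  qed (use assms in \<open>auto intro: less_imp_le\<close>)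
  also have "(\<Sum>i\<in>I. c i *\<^sub>R (h i + (1 / c i) *\<^sub>R f i)) = (\<Sum>i\<in>I. c i *\<^sub>R h i + f i)"
    by (rule sum.cong) (simp_all add: scaleR_add_right less_imp_neq[OF assms(3), symmetric])
  finally show ?thesis by (simp add: f sum.distrib)
qed

lemma flat_in_direction:
  assumes "subspace V" "flat_in V k F" "h \<in> F"
  shows "subspace ((\<lambda>x. x - h) ` F)" "dim ((\<lambda>x. x - h) ` F) = k" "(\<lambda>x. x - h) ` F \<subseteq> V"
proof -
  show sub: "subspace ((\<lambda>x. x - h) ` F)"
    using affine_diffs_subspace_subtract[of F h] assms by (simp add: flat_in_def)
  have "aff_dim ((\<lambda>x. x - h) ` F) = int k"
    using assms by (simp add: flat_in_def aff_dim_translation_eq_subtract)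
  then show "dim ((\<lambda>x. x - h) ` F) = k" using aff_dim_subspace[OF sub] by simp
  show "(\<lambda>x. x - h) ` F \<subseteq> V" using assms by (auto simp: flat_in_def intro: subspace_diff)
qed

theorem theorem3:
  fixes V :: "'a::euclidean_space set"
    and d k :: nat
    and H :: "nat \<Rightarrow> nat \<Rightarrow> 'a set"
  assumes "subspace V" and "dim V = d"
    and "k \<le> d"
    and "\<And>i e. i \<in> {1..d - k + 1} \<Longrightarrow> e \<in> {0, 1} \<Longrightarrow> flat_in V k (H i e)"
  shows "\<exists>(\<epsilon> :: nat \<Rightarrow> nat) A B.
           (\<forall>i\<in>{1..d - k + 1}. \<epsilon> i \<in> {0, 1}) \<and>
           A = {H i (\<epsilon> i) | i. i \<in> {1..d - k + 1}} \<and>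
           B = {H i (1 - \<epsilon> i) | i. i \<in> {1..d - k + 1}} \<and>
           (\<exists>F. flat_in V k F \<and> F \<subseteq> convex hull (\<Union>A) \<inter> convex hull (\<Union>B))"
proof -
  let ?I0 = "{1..d - k + 1}"
  define h where "h i e = (SOME x. x \<in> H i (of_bool e))" for i e
  define L where "L i e = (\<lambda>x. x - h i e) ` H i (of_bool e)" for i e
  have flat: "flat_in V k (H i (of_bool e))" if "i \<in> ?I0" for i e
    using assms(4)[OF that] by (cases e) auto
  have hH: "h i e \<in> H i (of_bool e)" if "i \<in> ?I0" for i e
  proof -
    have "H i (of_bool e) \<noteq> {}" using flat[OF that, of e] by (auto simp: flat_in_def)
    then show ?thesis unfolding h_def by (simp add: some_in_eq)
  qed
  have L: "subspace (L i e)" "dim (L i e) = k" "L i e \<subseteq> V" if "i \<in> ?I0" for i e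
    using flat_in_direction[OF assms(1) flat[OF that] hH[OF that]] unfolding L_def by blast+
  have hL: "h i e + v \<in> H i (of_bool e)" if "v \<in> L i e" for i e v
    using that by (auto simp: L_def)
  \<comment> \<open>The order matches the sign convention: if \<open>s i\<close> means
    \<open>l i < 0\<close>, then \<open>h i (s i) - h i (\<not> s i)\<close> is \<open>w i\<close>
    times the sign of \<open>l i\<close>, so the weight \<open>\<bar>l i\<bar>\<close> turns it into
    \<open>l i *\<^sub>R w i\<close>.\<close>
  define w where "w i = h i False - h i True" for i
  have wV: "w i \<in> V" if "i \<in> ?I0" for i
    unfolding w_def using hH[OF that] flat[OF that] assms(1)
    by (intro subspace_diff) (auto simp: flat_in_def)
  obtain I l where I: "I \<subseteq> ?I0" "I \<noteq> {}" and l: "\<And>i. i \<in> I \<Longrightarrow> l i \<noteq> (0::real)"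
    and dep: "(\<Sum>i\<in>I. l i *\<^sub>R w i) \<in> span (\<Union>i\<in>I. L i True \<union> L i False)"
    and k: "k \<le> dim (span (\<Union>i\<in>I. L i (l i < 0)) \<inter> span (\<Union>i\<in>I. L i (\<not> l i < 0)))"
    by (rule oriented_dependency[of ?I0 k L V w]) (use L wV assms in auto)
  have finI: "finite I" using I finite_subset by blast
  define s where "s i \<longleftrightarrow> l i < 0" for i
  define P where "P = span (\<Union>i\<in>I. L i (s i))"
  define Q where "Q = span (\<Union>i\<in>I. L i (\<not> s i))"
  define S where "S = (\<Sum>i\<in>I. \<bar>l i\<bar>)"
  have S: "S > 0" unfolding S_def using I finI l by (intro sum_pos) auto
  define c where "c i = \<bar>l i\<bar> / S" for i
  have c: "sum c I = 1" "\<And>i. i \<in> I \<Longrightarrow> c i > 0"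
    using S l by (auto simp: c_def S_def sum_divide_distrib[symmetric])
  define a where "a = (\<Sum>i\<in>I. c i *\<^sub>R h i (s i))"
  define b where "b = (\<Sum>i\<in>I. c i *\<^sub>R h i (\<not> s i))"
  have "c i *\<^sub>R h i (s i) - c i *\<^sub>R h i (\<not> s i) = (1 / S) *\<^sub>R (l i *\<^sub>R w i)" for i
    by (cases "l i < 0") (simp_all add: c_def s_def w_def scaleR_diff_right)
  then have "a - b = (\<Sum>i\<in>I. (1 / S) *\<^sub>R (l i *\<^sub>R w i))"
    unfolding a_def b_def sum_subtractf[symmetric] by simp
  then have "a - b = (1 / S) *\<^sub>R (\<Sum>i\<in>I. l i *\<^sub>R w i)" by (simp add: scaleR_sum_right)
  then have "a - b \<in> span (\<Union>i\<in>I. L i True \<union> L i False)" using dep by (simp add: span_scale)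
  also have "(\<Union>i\<in>I. L i True \<union> L i False) = (\<Union>i\<in>I. L i (s i)) \<union> (\<Union>i\<in>I. L i (\<not> s i))"
    by (auto; metis (full_types))
  finally obtain p q where pq: "p \<in> P" "q \<in> Q" "a - b = p + q"
    by (auto simp: span_Un P_def Q_def)
  \<comment> \<open>The intersection may have dimension larger than \<open>k\<close>, so a
    \<open>k\<close>-dimensional subspace of it is selected.\<close>
  obtain K where K: "subspace K" "K \<subseteq> P \<inter> Q" "dim K = k"
  proof -
    have "k \<le> dim (P \<inter> Q)" using k by (simp add: P_def Q_def s_def)
    then obtain K where "subspace K" "K \<subseteq> span (P \<inter> Q)" "dim K = k"
      by (rule choose_subspace_of_subspace)
    moreover have "span (P \<inter> Q) = P \<inter> Q"
      by (auto simp: span_eq_iff P_def Q_def intro: subspace_inter)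
    ultimately show thesis using that by auto
  qed
  \<comment> \<open>From \<open>a - b = p + q\<close> follows \<open>a - p = b + q\<close>, so
    \<open>F\<close> lies both in \<open>a + P\<close> and in \<open>b + Q\<close>.\<close>
  define F where "F = (+) (a - p) ` K"
  \<comment> \<open>Pairs outside \<open>I\<close> are distributed by the same formula; any
    placement would do, since they only enlarge the two unions.\<close>
  define \<epsilon> where "\<epsilon> i = (of_bool (s i) :: nat)" for i
  define A where "A = {H i (\<epsilon> i) | i. i \<in> ?I0}"
  define B where "B = {H i (1 - \<epsilon> i) | i. i \<in> ?I0}"
  have e: "1 - \<epsilon> i = of_bool (\<not> s i)" for i by (simp add: \<epsilon>_def)
  have inA: "h i (s i) + v \<in> \<Union>A" if "i \<in> I" "v \<in> L i (s i)" for i v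
    using hL[OF that(2)] that(1) I(1) unfolding A_def \<epsilon>_def by blast
  have FA: "F \<subseteq> convex hull (\<Union>A)"
  proof
    fix x assume "x \<in> F"
    then obtain y where y: "y \<in> K" "x = a + (y - p)" by (auto simp: F_def)
    have "y - p \<in> P" using y K pq by (auto simp: P_def intro: span_diff)
    then show "x \<in> convex hull (\<Union>A)"
      unfolding y a_def P_def
      by (intro translated_span_in_convex_hull[where L = "\<lambda>i. L i (s i)"] finI c L(1) inA)
        (use I in auto)
  qed
  have inB: "h i (\<not> s i) + v \<in> \<Union>B" if "i \<in> I" "v \<in> L i (\<not> s i)" for i v
    using hL[OF that(2)] that(1) I(1) unfolding B_def e by blast
  have FB: "F \<subseteq> convex hull (\<Union>B)"
  proof
    fix x assume "x \<in> F"
    then obtain y where y: "y \<in> K" "x = a + (y - p)" by (auto simp: F_def)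
    then have x: "x = b + (y + q)" using pq(3) by (simp add: algebra_simps)
    have "y + q \<in> Q" using y K pq by (auto simp: Q_def intro: span_add)
    then show "x \<in> convex hull (\<Union>B)"
      unfolding x b_def Q_def
      by (intro translated_span_in_convex_hull[where L = "\<lambda>i. L i (\<not> s i)"] finI c L(1) inB)
        (use I in auto)
  qed
  have "\<Union>A \<subseteq> V" using flat unfolding A_def \<epsilon>_def flat_in_def by blast
  then have "convex hull (\<Union>A) \<subseteq> V"
    using assms(1) by (simp add: hull_minimal subspace_imp_convex)
  moreover have "affine F" "aff_dim F = int k"
    unfolding F_def using K aff_dim_subspace[of K]
    by (auto simp: aff_dim_translation_eq affine_translation[symmetric] subspace_imp_affine)
  ultimately have "flat_in V k F" using FA by (auto simp: flat_in_def)
  then have "\<exists>F. flat_in V k F \<and> F \<subseteq> convex hull (\<Union>A) \<inter> convex hull (\<Union>B)"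
    using FA FB by blast
  moreover have "\<forall>i\<in>?I0. \<epsilon> i \<in> {0, 1}" by (simp add: \<epsilon>_def)
  ultimately show ?thesis using A_def B_def by blast
qed

end
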